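(* Assume there is $n\in\mathbb N^*$ (independent of $\omega$) such that $\theta_m=T$ a.s. for all $m\ge n$. Let $\xi=(\xi(\tau))_{\tau\in\Theta}$ be a $p$-integrable admissible family. Let $\rho$ satisfy admissibility, knowledge preservation, monotonicity, consistency and the generalized zero-one law. Define by backward induction $$U(\theta_n):=\xi(\theta_n),\qquad U(\theta_k):=\max\big(\xi(\theta_k),\,\rho_{\theta_k,\theta_{k+1}}[U(\theta_{k+1})]\big)\quad\text{for }k\in\{0,1,\dots,n-1\},$$ and, for $\tau=\sum_{k=0}^n\theta_k\mathbf 1_{A_k}\in\Theta$ with $(A_k)_{0\le k\le n}$ a partition of $\Omega$ such that $A_k\in\mathcal F_{\theta_k}$, set $U(\tau):=\sum_{k=0}^nU(\theta_k)\mathbf 1_{A_k}$. Then the family $U=(U(\tau))_{\tau\in\Theta}$ coincides with the $(\Theta,\rho)$-Snell envelope family of $\xi$, i.e. the smallest $(\Theta,\rho)$-supermartingale family dominating $\xi$.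
   Context: Setting. $T>0$ is fixed; $(\Omega,\mathcal F,P)$ is a complete probability space with a right-continuous complete filtration $(\mathcal F_t)_{t\in[0,T]}$. Equalities and inequalities between random variables (and between measurable sets) are understood $P$-a.s. $\mathbb N=\{0,1,2,\dots\}$, $\mathbb N^*=\mathbb N\setminus\{0\}$. $(\theta_k)_{k\in\mathbb N}$ is a sequence of stopping times with $\theta_0=0$, $\theta_k\le\theta_{k+1}$ a.s. for all $k$, and $\lim_{k}\theta_k=T$ a.s. $\Theta$ is the set of stopping times of the form $\tau=\sum_{k=0}^{\infty}\theta_k\mathbf 1_{A_k}+T\mathbf 1_{\bar A}$, where $\{(A_k)_{k\in\mathbb N},\bar A\}$ is a partition of $\Omega$ with $A_k\in\mathcal F_{\theta_k}$ for each $k$ and $\bar A\in\mathcal F_T$; when $\theta_m=T$ for all $m\ge n$, every $\tau\in\Theta$ can be written $\tau=\sum_{k=0}^n\theta_k\mathbf 1_{A_k}$ with $(A_k)_{0\le k\le n}$ a partition, $A_k\in\mathcal F_{\theta_k}$. For $\tau\in\Theta$, $\Theta_\tau=\{\nu\in\Theta:\nu\ge\tau \text{ a.s.}\}$. $p\in[1,+\infty]$ is fixed. (Under admissibility and knowledge preservation of $\rho$, $U(\theta_k)=U(\theta_{k+1})$ a.s. on $\{\theta_k=\theta_{k+1}\}$, so $U(\tau)$ does not depend on the chosen partition.) Families. A family $\phi=(\phi(\tau))_{\tau\in\Theta}$ is admissible if each $\phi(\tau)$ is a real-valued $\mathcal F_\tau$-measurable random variable and $\phi(\tau)=\phi(\tau')$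 a.s. on $\{\tau=\tau'\}$ for all $\tau,\tau'\in\Theta$; it is $p$-integrable if $\phi(\tau)\in L^p$ for all $\tau\in\Theta$. $\phi$ dominates $\phi'$ if $\phi(\tau)\ge\phi'(\tau)$ a.s. for all $\tau\in\Theta$. Operators. $\rho=(\rho_{S,\tau})_{S,\tau\in\Theta}$ is a family of (possibly non-linear) operators $\rho_{S,\tau}:L^p(\mathcal F_\tau)\to L^p(\mathcal F_S)$. Properties: - admissibility: $\rho_{S,\tau}[\eta]=\rho_{S',\tau}[\eta]$ a.s. on $\{S=S'\}$, for $S,S',\tau\in\Theta$, $\eta\in L^p(\mathcal F_\tau)$; - knowledge preservation: $\rho_{\tau,S}[\eta]=\eta$ for all $S\in\Theta$, $\tau\in\Theta_S$, $\eta\in L^p(\mathcal F_S)$; - monotonicity: $\rho_{S,\tau}[\eta_1]\le\rho_{S,\tau}[\eta_2]$ a.s. whenever $\eta_1\le\eta_2$ a.s., $\eta_1,\eta_2\in L^p(\mathcal F_\tau)$; - consistency: $\rho_{S,\theta}[\rho_{\theta,\tau}[\eta]]=\rho_{S,\tau}[\eta]$ for all $S,\theta,\tau\in\Theta$ with $S\le\theta\le\tau$ a.s. and $\eta\in L^p(\mathcal F_\tau)$; - generalized zero-one law: $\mathbf 1_A\rho_{S,\tau}[\zeta(\tau)]=\mathbf 1_A\rho_{S,\tau'}[\zeta(\tau')]$ for every $p$-integrable admissible family $\zeta$, $S\in\Theta$, $A\in\mathcal F_S$, and $\tau,\tau'\in\Theta_S$ with $\tau=\tau'$ on $A$. A $p$-integrable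 admissible family $\phi$ is a $(\Theta,\rho)$-supermartingale family if $\rho_{\sigma,\tau}[\phi(\tau)]\le\phi(\sigma)$ a.s. for all $\sigma,\tau\in\Theta$ with $\sigma\le\tau$ a.s. *)

theory Defs
  imports "HOL-Probability.Probability"
begin

text \<open>The filtration of the library is indexed by all reals. Since every stopping time below takes
  values in \<open>[0, T]\<close>, only the restriction of \<open>F\<close> to \<open>[0, T]\<close> matters: neither the stopping time
  property nor the stopped \<open>\<sigma>\<close>-algebra depends on \<open>F t\<close> for \<open>t\<close> outside \<open>[0, T]\<close>.\<close>

locale stopping_grid =
  prob_space M + complete_measure M + filtration "space M" F
  for M :: "'a measure" and F :: "real \<Rightarrow> 'a measure" +
  fixes T :: real and \<theta> :: "nat \<Rightarrow> 'a \<Rightarrow> real"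
  assumes T_pos: "0 < T"
    and sub_F: "sets (F T) \<subseteq> sets M"
    and complete_F: "null_sets M \<subseteq> sets (F 0)"
    and right_cont_F: "\<And>t. 0 \<le> t \<Longrightarrow> t < T \<Longrightarrow> sets (F t) = (\<Inter>s\<in>{t<..T}. sets (F s))"
    and stopping_\<theta>: "\<And>k. stopping_time F (\<theta> k)"
    and range_\<theta>: "\<And>k. \<theta> k \<in> space M \<rightarrow> {0..T}"
    and \<theta>_0: "AE \<omega> in M. \<theta> 0 \<omega> = 0"
    and \<theta>_mono: "\<And>k. AE \<omega> in M. \<theta> k \<omega> \<le> \<theta> (Suc k) \<omega>"
    and \<theta>_lim: "AE \<omega> in M. (\<lambda>k. \<theta> k \<omega>) \<longlonglongrightarrow> T"

abbreviation stopped_sigma :: "'a measure \<Rightarrow> (real \<Rightarrow> 'a measure) \<Rightarrow> ('a \<Rightarrow> real) \<Rightarrow> 'a measure" where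
  "stopped_sigma M F \<tau> \<equiv> filtration.pre_sigma (space M) F \<tau>"

text \<open>The set \<open>\<Theta>\<close>. The blocks of the partition may be empty.\<close>

definition grid_times ::
    "'a measure \<Rightarrow> (real \<Rightarrow> 'a measure) \<Rightarrow> real \<Rightarrow> (nat \<Rightarrow> 'a \<Rightarrow> real) \<Rightarrow> ('a \<Rightarrow> real) set" where
  "grid_times M F T \<theta> = {\<tau>. stopping_time F \<tau> \<and> \<tau> \<in> space M \<rightarrow> {0..T} \<and>
     (\<exists>A B. (\<forall>k. A k \<in> sets (stopped_sigma M F (\<theta> k))) \<and> B \<in> sets (F T) \<and>
        disjoint_family A \<and> (\<forall>k. A k \<inter> B = {}) \<and> (\<Union>k. A k) \<union> B = space M \<and>
        (AE \<omega> in M. \<tau> \<omega> = (\<Sum>k. \<theta> k \<omega> * indicator (A k) \<omega>) + T * indicator B \<omega>))}"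

definition grid_times_from :: "'a measure \<Rightarrow> ('a \<Rightarrow> real) set \<Rightarrow> ('a \<Rightarrow> real) \<Rightarrow> ('a \<Rightarrow> real) set" where
  "grid_times_from M \<Theta> \<tau> = {\<nu>\<in>\<Theta>. AE \<omega> in M. \<tau> \<omega> \<le> \<nu> \<omega>}"

text \<open>Representatives of the classes in \<open>L\<^sup>p(G)\<close>, for \<open>p \<in> [1, \<infinity>]\<close> and a sub-\<open>\<sigma>\<close>-algebra \<open>G\<close>.\<close>

definition Lp :: "'a measure \<Rightarrow> ennreal \<Rightarrow> 'a measure \<Rightarrow> ('a \<Rightarrow> real) set" where
  "Lp M p G = {\<eta> \<in> borel_measurable G.
     if p = \<infinity> then \<exists>C. AE \<omega> in M. \<bar>\<eta> \<omega>\<bar> \<le> C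
     else integrable M (\<lambda>\<omega>. \<bar>\<eta> \<omega>\<bar> powr enn2real p)}"

subsection \<open>Families of random variables\<close>

text \<open>A family indexed by \<open>\<Theta>\<close> is a function on all of \<open>'a \<Rightarrow> real\<close>; its values outside \<open>\<Theta>\<close> play no role.\<close>

definition admissible_family ::
    "'a measure \<Rightarrow> (real \<Rightarrow> 'a measure) \<Rightarrow> ('a \<Rightarrow> real) set \<Rightarrow> (('a \<Rightarrow> real) \<Rightarrow> 'a \<Rightarrow> real) \<Rightarrow> bool" where
  "admissible_family M F \<Theta> \<phi> \<longleftrightarrow>
     (\<forall>\<tau>\<in>\<Theta>. \<phi> \<tau> \<in> borel_measurable (stopped_sigma M F \<tau>)) \<and>
     (\<forall>\<tau>\<in>\<Theta>. \<forall>\<tau>'\<in>\<Theta>. AE \<omega> in M. \<tau> \<omega> = \<tau>' \<omega> \<longrightarrow> \<phi> \<tau> \<omega> = \<phi> \<tau>' \<omega>)"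

definition p_integrable_family ::
    "'a measure \<Rightarrow> (real \<Rightarrow> 'a measure) \<Rightarrow> ('a \<Rightarrow> real) set \<Rightarrow> ennreal \<Rightarrow>
      (('a \<Rightarrow> real) \<Rightarrow> 'a \<Rightarrow> real) \<Rightarrow> bool" where
  "p_integrable_family M F \<Theta> p \<phi> \<longleftrightarrow> (\<forall>\<tau>\<in>\<Theta>. \<phi> \<tau> \<in> Lp M p (stopped_sigma M F \<tau>))"

definition dominates ::
    "'a measure \<Rightarrow> ('a \<Rightarrow> real) set \<Rightarrow> (('a \<Rightarrow> real) \<Rightarrow> 'a \<Rightarrow> real) \<Rightarrow>
      (('a \<Rightarrow> real) \<Rightarrow> 'a \<Rightarrow> real) \<Rightarrow> bool" where
  "dominates M \<Theta> \<phi> \<phi>' \<longleftrightarrow> (\<forall>\<tau>\<in>\<Theta>. AE \<omega> in M. \<phi>' \<tau> \<omega> \<le> \<phi> \<tau> \<omega>)"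

subsection \<open>Families of operators\<close>

type_synonym 'a operator_family =
  "('a \<Rightarrow> real) \<Rightarrow> ('a \<Rightarrow> real) \<Rightarrow> ('a \<Rightarrow> real) \<Rightarrow> 'a \<Rightarrow> real"

text \<open>\<open>\<rho> S \<tau>\<close> acts on representatives; the second conjunct says that it descends to a map between
  the spaces of almost sure equivalence classes.\<close>

definition Lp_operators ::
    "'a measure \<Rightarrow> (real \<Rightarrow> 'a measure) \<Rightarrow> ('a \<Rightarrow> real) set \<Rightarrow> ennreal \<Rightarrow> 'a operator_family \<Rightarrow> bool" where
  "Lp_operators M F \<Theta> p \<rho> \<longleftrightarrow> (\<forall>S\<in>\<Theta>. \<forall>\<tau>\<in>\<Theta>.
     (\<forall>\<eta>\<in>Lp M p (stopped_sigma M F \<tau>). \<rho> S \<tau> \<eta> \<in> Lp M p (stopped_sigma M F S)) \<and>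
     (\<forall>\<eta>1\<in>Lp M p (stopped_sigma M F \<tau>). \<forall>\<eta>2\<in>Lp M p (stopped_sigma M F \<tau>).
        (AE \<omega> in M. \<eta>1 \<omega> = \<eta>2 \<omega>) \<longrightarrow> (AE \<omega> in M. \<rho> S \<tau> \<eta>1 \<omega> = \<rho> S \<tau> \<eta>2 \<omega>)))"

definition admissible_operators ::
    "'a measure \<Rightarrow> (real \<Rightarrow> 'a measure) \<Rightarrow> ('a \<Rightarrow> real) set \<Rightarrow> ennreal \<Rightarrow> 'a operator_family \<Rightarrow> bool" where
  "admissible_operators M F \<Theta> p \<rho> \<longleftrightarrow>
     (\<forall>S\<in>\<Theta>. \<forall>S'\<in>\<Theta>. \<forall>\<tau>\<in>\<Theta>. \<forall>\<eta>\<in>Lp M p (stopped_sigma M F \<tau>).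
        AE \<omega> in M. S \<omega> = S' \<omega> \<longrightarrow> \<rho> S \<tau> \<eta> \<omega> = \<rho> S' \<tau> \<eta> \<omega>)"

definition knowledge_preserving ::
    "'a measure \<Rightarrow> (real \<Rightarrow> 'a measure) \<Rightarrow> ('a \<Rightarrow> real) set \<Rightarrow> ennreal \<Rightarrow> 'a operator_family \<Rightarrow> bool" where
  "knowledge_preserving M F \<Theta> p \<rho> \<longleftrightarrow>
     (\<forall>S\<in>\<Theta>. \<forall>\<tau>\<in>grid_times_from M \<Theta> S. \<forall>\<eta>\<in>Lp M p (stopped_sigma M F S).
        AE \<omega> in M. \<rho> \<tau> S \<eta> \<omega> = \<eta> \<omega>)"

definition monotone_operators ::
    "'a measure \<Rightarrow> (real \<Rightarrow> 'a measure) \<Rightarrow> ('a \<Rightarrow> real) set \<Rightarrow> ennreal \<Rightarrow> 'a operator_family \<Rightarrow> bool" where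
  "monotone_operators M F \<Theta> p \<rho> \<longleftrightarrow>
     (\<forall>S\<in>\<Theta>. \<forall>\<tau>\<in>\<Theta>. \<forall>\<eta>1\<in>Lp M p (stopped_sigma M F \<tau>). \<forall>\<eta>2\<in>Lp M p (stopped_sigma M F \<tau>).
        (AE \<omega> in M. \<eta>1 \<omega> \<le> \<eta>2 \<omega>) \<longrightarrow> (AE \<omega> in M. \<rho> S \<tau> \<eta>1 \<omega> \<le> \<rho> S \<tau> \<eta>2 \<omega>))"

definition consistent_operators ::
    "'a measure \<Rightarrow> (real \<Rightarrow> 'a measure) \<Rightarrow> ('a \<Rightarrow> real) set \<Rightarrow> ennreal \<Rightarrow> 'a operator_family \<Rightarrow> bool" where
  "consistent_operators M F \<Theta> p \<rho> \<longleftrightarrow>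
     (\<forall>S\<in>\<Theta>. \<forall>\<nu>\<in>\<Theta>. \<forall>\<tau>\<in>\<Theta>. (AE \<omega> in M. S \<omega> \<le> \<nu> \<omega>) \<longrightarrow> (AE \<omega> in M. \<nu> \<omega> \<le> \<tau> \<omega>) \<longrightarrow>
        (\<forall>\<eta>\<in>Lp M p (stopped_sigma M F \<tau>). AE \<omega> in M. \<rho> S \<nu> (\<rho> \<nu> \<tau> \<eta>) \<omega> = \<rho> S \<tau> \<eta> \<omega>))"

definition zero_one_law ::
    "'a measure \<Rightarrow> (real \<Rightarrow> 'a measure) \<Rightarrow> ('a \<Rightarrow> real) set \<Rightarrow> ennreal \<Rightarrow> 'a operator_family \<Rightarrow> bool" where
  "zero_one_law M F \<Theta> p \<rho> \<longleftrightarrow>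
     (\<forall>\<zeta>. admissible_family M F \<Theta> \<zeta> \<longrightarrow> p_integrable_family M F \<Theta> p \<zeta> \<longrightarrow>
        (\<forall>S\<in>\<Theta>. \<forall>A\<in>sets (stopped_sigma M F S).
           \<forall>\<tau>\<in>grid_times_from M \<Theta> S. \<forall>\<tau>'\<in>grid_times_from M \<Theta> S.
             (AE \<omega> in M. \<omega> \<in> A \<longrightarrow> \<tau> \<omega> = \<tau>' \<omega>) \<longrightarrow>
             (AE \<omega> in M. indicator A \<omega> * \<rho> S \<tau> (\<zeta> \<tau>) \<omega> = indicator A \<omega> * \<rho> S \<tau>' (\<zeta> \<tau>') \<omega>)))"

subsection \<open>Supermartingale and Snell envelope families\<close>

definition supermartingale_family ::
    "'a measure \<Rightarrow> (real \<Rightarrow> 'a measure) \<Rightarrow> ('a \<Rightarrow> real) set \<Rightarrow> ennreal \<Rightarrow> 'a operator_family \<Rightarrow>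
      (('a \<Rightarrow> real) \<Rightarrow> 'a \<Rightarrow> real) \<Rightarrow> bool" where
  "supermartingale_family M F \<Theta> p \<rho> \<phi> \<longleftrightarrow>
     admissible_family M F \<Theta> \<phi> \<and> p_integrable_family M F \<Theta> p \<phi> \<and>
     (\<forall>\<sigma>\<in>\<Theta>. \<forall>\<tau>\<in>\<Theta>. (AE \<omega> in M. \<sigma> \<omega> \<le> \<tau> \<omega>) \<longrightarrow> (AE \<omega> in M. \<rho> \<sigma> \<tau> (\<phi> \<tau>) \<omega> \<le> \<phi> \<sigma> \<omega>))"

definition snell_envelope ::
    "'a measure \<Rightarrow> (real \<Rightarrow> 'a measure) \<Rightarrow> ('a \<Rightarrow> real) set \<Rightarrow> ennreal \<Rightarrow> 'a operator_family \<Rightarrow>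
      (('a \<Rightarrow> real) \<Rightarrow> 'a \<Rightarrow> real) \<Rightarrow> (('a \<Rightarrow> real) \<Rightarrow> 'a \<Rightarrow> real) \<Rightarrow> bool" where
  "snell_envelope M F \<Theta> p \<rho> \<xi> V \<longleftrightarrow>
     supermartingale_family M F \<Theta> p \<rho> V \<and> dominates M \<Theta> V \<xi> \<and>
     (\<forall>W. supermartingale_family M F \<Theta> p \<rho> W \<longrightarrow> dominates M \<Theta> W \<xi> \<longrightarrow> dominates M \<Theta> W V)"

subsection \<open>The backward induction\<close>

text \<open>\<open>backward_value \<theta> \<rho> \<xi> n k\<close> is \<open>U(\<theta>\<^sub>k)\<close> for \<open>k \<le> n\<close>; the values for \<open>k > n\<close> are not used.\<close>

function backward_value ::
    "(nat \<Rightarrow> 'a \<Rightarrow> real) \<Rightarrow> 'a operator_family \<Rightarrow> (('a \<Rightarrow> real) \<Rightarrow> 'a \<Rightarrow> real) \<Rightarrow> nat \<Rightarrow> nat \<Rightarrow> 'a \<Rightarrow> real" where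
  "backward_value \<theta> \<rho> \<xi> n k =
     (if k < n
      then (\<lambda>\<omega>. max (\<xi> (\<theta> k) \<omega>) (\<rho> (\<theta> k) (\<theta> (Suc k)) (backward_value \<theta> \<rho> \<xi> n (Suc k)) \<omega>))
      else \<xi> (\<theta> n))"
  by pat_completeness auto
termination
  by (relation "Wellfounded.measure (\<lambda>(\<theta>, \<rho>, \<xi>, n, k). n - k)") auto

declare backward_value.simps [simp del]

text \<open>\<open>A\<close> is a partition representing \<open>\<tau>\<close> as \<open>\<Sum>\<^bsub>k\<le>n\<^esub> \<theta>\<^sub>k 1\<^bsub>A k\<^esub>\<close>.\<close>

definition grid_partition ::
    "'a measure \<Rightarrow> (real \<Rightarrow> 'a measure) \<Rightarrow> (nat \<Rightarrow> 'a \<Rightarrow> real) \<Rightarrow> nat \<Rightarrow> ('a \<Rightarrow> real) \<Rightarrow>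
      (nat \<Rightarrow> 'a set) \<Rightarrow> bool" where
  "grid_partition M F \<theta> n \<tau> A \<longleftrightarrow>
     (\<forall>k\<le>n. A k \<in> sets (stopped_sigma M F (\<theta> k))) \<and>
     disjoint_family_on A {..n} \<and> (\<Union>k\<le>n. A k) = space M \<and>
     (AE \<omega> in M. \<tau> \<omega> = (\<Sum>k\<le>n. \<theta> k \<omega> * indicator (A k) \<omega>))"

text \<open>The family \<open>U\<close>, where \<open>P \<tau>\<close> is the partition chosen to represent \<open>\<tau>\<close>.\<close>

definition backward_family ::
    "(nat \<Rightarrow> 'a \<Rightarrow> real) \<Rightarrow> 'a operator_family \<Rightarrow> (('a \<Rightarrow> real) \<Rightarrow> 'a \<Rightarrow> real) \<Rightarrow> nat \<Rightarrow>
      (('a \<Rightarrow> real) \<Rightarrow> nat \<Rightarrow> 'a set) \<Rightarrow> ('a \<Rightarrow> real) \<Rightarrow> 'a \<Rightarrow> real" where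
  "backward_family \<theta> \<rho> \<xi> n P \<tau> = (\<lambda>\<omega>. \<Sum>k\<le>n. backward_value \<theta> \<rho> \<xi> n k \<omega> * indicator (P \<tau> k) \<omega>)"

text \<open>When the grid is finite, every element of \<open>\<Theta>\<close> does have such a representation.\<close>

lemma grid_partition_exists:
  assumes "stopping_grid M F T \<theta>"
    and fin: "\<And>m. m \<ge> n \<Longrightarrow> AE \<omega> in M. \<theta> m \<omega> = T"
    and \<tau>: "\<tau> \<in> grid_times M F T \<theta>"
  shows "\<exists>A. grid_partition M F \<theta> n \<tau> A"
proof -
  interpret stopping_grid M F T \<theta> by fact
  from \<tau> obtain A B where A: "\<And>k. A k \<in> sets (pre_sigma (\<theta> k))" and B: "B \<in> sets (F T)"
    and disj: "disjoint_family A" "\<And>k. A k \<inter> B = {}" and un: "(\<Union>k. A k) \<union> B = space M"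
    and eq: "AE \<omega> in M. \<tau> \<omega> = (\<Sum>k. \<theta> k \<omega> * indicator (A k) \<omega>) + T * indicator B \<omega>"
    unfolding grid_times_def mem_Collect_eq by (elim conjE exE) (rule that; simp)
  have sub: "A k \<subseteq> space M" for k using un by auto
  have AT: "A k \<in> sets (F T)" for k
  proof -
    have "{\<omega>\<in>A k. \<theta> k \<omega> \<le> T} \<in> sets (F T)"
      by (rule sets_pre_sigmaD[OF stopping_\<theta> A])
    moreover have "{\<omega>\<in>A k. \<theta> k \<omega> \<le> T} = A k"
      using range_\<theta>[of k] sub[of k] by (auto simp: Pi_iff)
    ultimately show ?thesis by simp
  qed
  define A' where "A' k = (if k < n then A k else space M - (\<Union>j<n. A j))" for k
  have An: "A' n \<in> sets (F T)"
  proof -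
    have "space (F T) - (\<Union>j<n. A j) \<in> sets (F T)"
      using AT by (intro sets.Diff sets.top sets.finite_UN) auto
    then show ?thesis by (simp add: A'_def space_F)
  qed
  have "A' n \<in> sets (pre_sigma (\<theta> n))"
  proof (rule sets_pre_sigmaI[OF stopping_\<theta>])
    fix t :: real
    show "{\<omega>\<in>A' n. \<theta> n \<omega> \<le> t} \<in> sets (F t)"
    proof (cases "t \<ge> T")
      case True
      have "{\<omega>\<in>A' n. \<theta> n \<omega> \<le> t} = A' n"
        using range_\<theta>[of n] True by (fastforce simp: A'_def Pi_iff)
      then show ?thesis using An sets_F_mono[OF True] by auto
    next
      case False
      show ?thesis
      proof (cases "t < 0")
        case True
        then have "{\<omega>\<in>A' n. \<theta> n \<omega> \<le> t} = {}"
          using range_\<theta>[of n] by (fastforce simp: A'_def Pi_iff)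
        then show ?thesis by (metis sets.empty_sets)
      next
        case t0: False
        obtain N where N: "N \<in> null_sets M" "{\<omega>\<in>space M. \<theta> n \<omega> \<noteq> T} \<subseteq> N"
          using fin[of n] unfolding eventually_ae_filter by auto
        have "{\<omega>\<in>A' n. \<theta> n \<omega> \<le> t} \<subseteq> N"
          using N(2) False by (auto simp: A'_def)
        then have "{\<omega>\<in>A' n. \<theta> n \<omega> \<le> t} \<in> null_sets M"
          by (metis N(1) complete null_sets_subset)
        moreover have "sets (F 0) \<subseteq> sets (F t)"
          using t0 by (intro sets_F_mono) simp
        ultimately show ?thesis using complete_F by (meson subsetD)
      qed
    qed
  qed
  then have 1: "\<forall>k\<le>n. A' k \<in> sets (pre_sigma (\<theta> k))"
    using A by (auto simp: A'_def le_less)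
  have 2: "disjoint_family_on A' {..n}"
    using disj(1) by (auto simp: disjoint_family_on_def A'_def)
  have 3: "(\<Union>k\<le>n. A' k) = space M"
    using sub by (auto simp: A'_def)
  have "AE \<omega> in M. \<forall>m\<in>{n..}. \<theta> m \<omega> = T"
    using fin by (subst AE_ball_countable) auto
  then have 4: "AE \<omega> in M. \<tau> \<omega> = (\<Sum>k\<le>n. \<theta> k \<omega> * indicator (A' k) \<omega>)"
    using eq AE_space
  proof eventually_elim
    case (elim \<omega>)
    have one: "(\<Sum>k\<le>n. \<theta> k \<omega> * indicator (A' k) \<omega>) = \<theta> j \<omega>" if "j \<le> n" "\<omega> \<in> A' j" for j
    proof -
      have "(\<Sum>k\<le>n. \<theta> k \<omega> * indicator (A' k) \<omega>) = (\<Sum>k\<le>n. if k = j then \<theta> j \<omega> else 0)"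
        using that 2 by (intro sum.cong) (auto simp: disjoint_family_on_def indicator_def)
      then show ?thesis using that by simp
    qed
    show ?case
    proof (cases "\<omega> \<in> B")
      case True
      then have "\<omega> \<notin> A k" for k using disj(2) by auto
      moreover from this have "\<omega> \<in> A' n" using elim by (auto simp: A'_def)
      ultimately show ?thesis using one[of n] elim True by (simp add: indicator_def)
    next
      case False
      then obtain j where j: "\<omega> \<in> A j" using un elim by auto
      have other: "\<omega> \<notin> A k" if "k \<noteq> j" for k
        using disj(1) j that by (auto simp: disjoint_family_on_def)
      have "(\<Sum>k. \<theta> k \<omega> * indicator (A k) \<omega>) = (\<Sum>k\<in>{j}. \<theta> k \<omega> * indicator (A k) \<omega>)"
        using other by (intro suminf_finite) auto
      then have \<tau>j: "\<tau> \<omega> = \<theta> j \<omega>" using elim False j by simp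
      show ?thesis
      proof (cases "j < n")
        case True
        then show ?thesis using one[of j] j \<tau>j by (simp add: A'_def)
      next
        case False
        then have "\<omega> \<in> A' n" using other elim by (auto simp: A'_def)
        then show ?thesis using one[of n] \<tau>j elim False by simp
      qed
    qed
  qed
  show ?thesis
    unfolding grid_partition_def using 1 2 3 4 by blast
qed

end

theory Submission
  imports Defs
begin

text \<open>Since \<open>\<rho>\<close> is admissible and preserves knowledge, \<open>U(\<theta>\<^sub>k) = U(\<theta>\<^sub>j)\<close> almost surely on
  \<open>{\<theta>\<^sub>k = \<theta>\<^sub>j}\<close>; hence \<open>U(\<tau>) = U(\<theta>\<^sub>k)\<close> on \<open>{\<tau> = \<theta>\<^sub>k}\<close> whatever partition is chosen, and \<open>U\<close> is an
  admissible \<open>p\<close>-integrable family. The inequality \<open>\<rho>\<^bsub>\<theta>\<^sub>k,\<tau>\<^esub>[U(\<tau>)] \<le> U(\<theta>\<^sub>k)\<close> for \<open>\<tau> \<ge> \<theta>\<^sub>k\<close> follows by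
  backward induction on \<open>k\<close>: on \<open>{\<tau> > \<theta>\<^sub>k}\<close> the zero-one law replaces \<open>\<tau>\<close> by \<open>max \<tau> \<theta>\<^bsub>k+1\<^esub>\<close>, and
  consistency and monotonicity reduce the claim to the step from \<open>k\<close> to \<open>k + 1\<close>; on \<open>{\<tau> = \<theta>\<^sub>k}\<close> it
  is knowledge preservation. For a general \<open>\<sigma> \<le> \<tau>\<close> one argues on each \<open>{\<sigma> = \<theta>\<^sub>k}\<close>, replacing \<open>\<tau>\<close> by
  \<open>max \<tau> \<theta>\<^sub>k\<close>. Minimality is a backward induction along the grid.\<close>

section \<open>Membership in \<open>Lp\<close> by domination\<close>

lemma borel_measurable_Lp: "\<eta> \<in> Lp M p G \<Longrightarrow> \<eta> \<in> borel_measurable G"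
  by (simp add: Lp_def)

text \<open>The index \<open>i\<close> may change with \<omega>, so \<open>f\<close> is compared
  with a finite sum over \<open>I\<close>: the sum of the constants \<open>\<bar>C i\<bar>\<close>
  when \<open>p\<close> is infinite, the sum of the powers of
  \<open>\<bar>g i \<omega>\<bar>\<close> otherwise. The \<sigma>-algebras \<open>H i\<close> may
  differ, as they do when a family is pasted together from values at different grid times.\<close>

lemma Lp_dominated:
  assumes f: "f \<in> borel_measurable G" and G: "sets G \<subseteq> sets M" "space G = space M"
    and I: "finite I" and g: "\<And>i. i \<in> I \<Longrightarrow> g i \<in> Lp M p (H i)"
    and le: "AE \<omega> in M. \<exists>i\<in>I. \<bar>f \<omega>\<bar> \<le> \<bar>g i \<omega>\<bar>"
  shows "f \<in> Lp M p G"
proof (cases "p = \<infinity>")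
  case True
  then have "\<forall>i\<in>I. \<exists>C. AE \<omega> in M. \<bar>g i \<omega>\<bar> \<le> C"
    using g by (auto simp: Lp_def)
  then obtain C where "\<And>i. i \<in> I \<Longrightarrow> AE \<omega> in M. \<bar>g i \<omega>\<bar> \<le> C i"
    by metis
  then have "AE \<omega> in M. \<forall>i\<in>I. \<bar>g i \<omega>\<bar> \<le> C i"
    using I by (simp add: AE_finite_all)
  with le have "AE \<omega> in M. \<bar>f \<omega>\<bar> \<le> (\<Sum>i\<in>I. \<bar>C i\<bar>)"
  proof eventually_elim
    case (elim \<omega>)
    then obtain i where i: "i \<in> I" "\<bar>f \<omega>\<bar> \<le> \<bar>g i \<omega>\<bar>" by blast
    with elim have "\<bar>f \<omega>\<bar> \<le> \<bar>C i\<bar>" by force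
    also have "\<dots> \<le> (\<Sum>i\<in>I. \<bar>C i\<bar>)" using i I by (intro member_le_sum) auto
    finally show ?case .
  qed
  then show ?thesis using f True by (auto simp: Lp_def)
next
  case False
  let ?q = "enn2real p"
  have fM: "f \<in> borel_measurable M"
    using f G by (auto simp: measurable_def)
  have "integrable M (\<lambda>\<omega>. \<Sum>i\<in>I. \<bar>g i \<omega>\<bar> powr ?q)"
    using g False by (intro Bochner_Integration.integrable_sum) (auto simp: Lp_def)
  moreover have "(\<lambda>\<omega>. \<bar>f \<omega>\<bar> powr ?q) \<in> borel_measurable M"
    using fM by measurable
  moreover have "AE \<omega> in M. norm (\<bar>f \<omega>\<bar> powr ?q) \<le> norm (\<Sum>i\<in>I. \<bar>g i \<omega>\<bar> powr ?q)"
    using le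
  proof eventually_elim
    case (elim \<omega>)
    then obtain i where i: "i \<in> I" "\<bar>f \<omega>\<bar> \<le> \<bar>g i \<omega>\<bar>" by blast
    have "\<bar>f \<omega>\<bar> powr ?q \<le> \<bar>g i \<omega>\<bar> powr ?q" using i by (intro powr_mono2) auto
    also have "\<dots> \<le> (\<Sum>i\<in>I. \<bar>g i \<omega>\<bar> powr ?q)" using i I by (intro member_le_sum) auto
    finally show ?case by (simp add: sum_nonneg)
  qed
  ultimately have "integrable M (\<lambda>\<omega>. \<bar>f \<omega>\<bar> powr ?q)"
    by (rule Bochner_Integration.integrable_bound)
  then show ?thesis using f False by (auto simp: Lp_def)
qed

section \<open>Stopped \<sigma>-algebras up to null sets\<close>

context stopping_grid
begin

text \<open>Both differences \<open>A - B\<close> and \<open>B - A\<close> are null, hence belong to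
  \<open>F 0\<close> and so to \<open>F t\<close>; \<open>A\<close> is obtained from
  \<open>B\<close> by removing one and adding the other.\<close>

lemma sets_F_AE_cong:
  assumes B: "B \<in> sets (F t)" and t: "0 \<le> t" and A: "A \<subseteq> space M"
    and eq: "AE \<omega> in M. \<omega> \<in> A \<longleftrightarrow> \<omega> \<in> B"
  shows "A \<in> sets (F t)"
proof -
  have BM: "B \<subseteq> space M" using sets.sets_into_space[OF B] by (simp add: space_F)
  have N: "{\<omega>\<in>space M. \<not> (\<omega> \<in> A \<longleftrightarrow> \<omega> \<in> B)} \<in> null_sets M"
    using eq by (simp add: AE_iff_null_sets)
  have null: "C \<in> sets (F t)" if "C \<subseteq> {\<omega>\<in>space M. \<not> (\<omega> \<in> A \<longleftrightarrow> \<omega> \<in> B)}" for C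
    using complete2[OF that N] complete_F sets_F_mono[OF t] by auto
  have "A - B \<in> sets (F t)" "B - A \<in> sets (F t)"
    using A BM by (auto intro!: null)
  then have "(B - (B - A)) \<union> (A - B) \<in> sets (F t)" using B by auto
  also have "(B - (B - A)) \<union> (A - B) = A" by auto
  finally show ?thesis .
qed

lemma sets_pre_sigma_subset:
  assumes "stopping_time F \<tau>" "\<tau> \<in> space M \<rightarrow> {0..T}"
  shows "sets (pre_sigma \<tau>) \<subseteq> sets M"
proof
  fix A assume A: "A \<in> sets (pre_sigma \<tau>)"
  have "{\<omega>\<in>A. \<tau> \<omega> \<le> T} \<in> sets (F T)" by (rule sets_pre_sigmaD[OF assms(1) A])
  also have "{\<omega>\<in>A. \<tau> \<omega> \<le> T} = A"
    using assms(2) sets.sets_into_space[OF A] by (auto simp: space_pre_sigma)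
  finally show "A \<in> sets M" using sub_F by auto
qed

text \<open>Up to a null set, \<open>A\<close> meets \<open>{\<tau> \<le> t}\<close> in the
  intersection of \<open>{\<omega>\<in>A. \<sigma> \<omega> \<le> t}\<close> with
  \<open>{\<tau> \<le> t}\<close>. The comparison of the two times is required only on
  \<open>A\<close> and only almost surely, which is how the blocks of a partition present
  it.\<close>

lemma sets_pre_sigma_AE_mono:
  assumes \<sigma>: "stopping_time F \<sigma>" and \<tau>: "stopping_time F \<tau>" "\<tau> \<in> space M \<rightarrow> {0..T}"
    and A: "A \<in> sets (pre_sigma \<sigma>)" and le: "AE \<omega> in M. \<omega> \<in> A \<longrightarrow> \<sigma> \<omega> \<le> \<tau> \<omega>"
  shows "A \<in> sets (pre_sigma \<tau>)"
proof (rule sets_pre_sigmaI[OF \<tau>(1)])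
  fix t :: real
  have sub: "A \<subseteq> space M" using sets.sets_into_space[OF A] by (simp add: space_pre_sigma)
  show "{\<omega>\<in>A. \<tau> \<omega> \<le> t} \<in> sets (F t)"
  \<comment> \<open>Null sets are known to be in \<open>F t\<close> only from time 0 on; for
    negative \<open>t\<close> the set is exactly empty because \<open>\<tau>\<close> takes values in
    [0, T] everywhere.\<close>
  proof (cases "0 \<le> t")
    case True
    have "{\<omega>\<in>A. \<sigma> \<omega> \<le> t} \<inter> {\<omega>\<in>space (F t). \<tau> \<omega> \<le> t} \<in> sets (F t)"
      using sets_pre_sigmaD[OF \<sigma> A, of t] stopping_timeD[OF \<tau>(1), of t] by (auto simp: pred_def)
    then show ?thesis
      by (rule sets_F_AE_cong[OF _ True]) (use le sub in \<open>auto simp: space_F\<close>)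
  next
    case False
    moreover have "0 \<le> \<tau> \<omega>" if "\<omega> \<in> A" for \<omega>
      using \<tau>(2) sub that by (auto simp: Pi_iff)
    ultimately have "{\<omega>\<in>A. \<tau> \<omega> \<le> t} = {}" by fastforce
    then show ?thesis by (metis sets.empty_sets)
  qed
qed

text \<open>The event \<open>\<sigma> \<omega> < \<tau> \<omega>\<close> is first found in
  \<open>pre_sigma \<sigma>\<close> and then moved to \<open>pre_sigma \<tau>\<close>, since
  \<sigma> is below \<tau> on it. Removing both strict inequalities leaves equality.\<close>

lemma sets_stopping_time_eq:
  assumes \<sigma>: "stopping_time F \<sigma>" and \<tau>: "stopping_time F \<tau>" "\<tau> \<in> space M \<rightarrow> {0..T}"
  shows "{\<omega>\<in>space M. \<tau> \<omega> = \<sigma> \<omega>} \<in> sets (pre_sigma \<tau>)"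
proof -
  have "{\<omega>\<in>space M. \<tau> \<omega> < \<sigma> \<omega>} \<in> sets (pre_sigma \<tau>)"
    using stopping_time_less[OF \<tau>(1) \<sigma>] by (simp add: pred_def space_pre_sigma)
  moreover have "{\<omega>\<in>space M. \<sigma> \<omega> < \<tau> \<omega>} \<in> sets (pre_sigma \<sigma>)"
    using stopping_time_less[OF \<sigma> \<tau>(1)] by (simp add: pred_def space_pre_sigma)
  then have "{\<omega>\<in>space M. \<sigma> \<omega> < \<tau> \<omega>} \<in> sets (pre_sigma \<tau>)"
    by (rule sets_pre_sigma_AE_mono[OF \<sigma> \<tau>]) auto
  ultimately have "space (pre_sigma \<tau>) - ({\<omega>\<in>space M. \<tau> \<omega> < \<sigma> \<omega>} \<union> {\<omega>\<in>space M. \<sigma> \<omega> < \<tau> \<omega>})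
      \<in> sets (pre_sigma \<tau>)"
    by (intro sets.compl_sets sets.Un)
  also have "space (pre_sigma \<tau>) - ({\<omega>\<in>space M. \<tau> \<omega> < \<sigma> \<omega>} \<union> {\<omega>\<in>space M. \<sigma> \<omega> < \<tau> \<omega>})
      = {\<omega>\<in>space M. \<tau> \<omega> = \<sigma> \<omega>}"
    by (auto simp: space_pre_sigma)
  finally show ?thesis .
qed

text \<open>Inside \<open>A\<close> the sublevel sets of \<open>g\<close> pass from
  \<open>pre_sigma \<sigma>\<close> to \<open>pre_sigma \<tau>\<close>. This makes each summand of
  \<open>U \<tau>\<close> measurable at time \<tau>.\<close>

lemma measurable_mult_indicator_pre_sigma:
  fixes g :: "'a \<Rightarrow> real"
  assumes \<sigma>: "stopping_time F \<sigma>" and \<tau>: "stopping_time F \<tau>" "\<tau> \<in> space M \<rightarrow> {0..T}"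
    and g: "g \<in> borel_measurable (pre_sigma \<sigma>)" and A: "A \<in> sets (pre_sigma \<sigma>)"
    and le: "AE \<omega> in M. \<omega> \<in> A \<longrightarrow> \<sigma> \<omega> \<le> \<tau> \<omega>"
  shows "(\<lambda>\<omega>. g \<omega> * indicator A \<omega>) \<in> borel_measurable (pre_sigma \<tau>)"
proof (rule borel_measurableI_le)
  fix c :: real
  have sub: "A \<subseteq> space M" using sets.sets_into_space[OF A] by (simp add: space_pre_sigma)
  have A\<tau>: "A \<in> sets (pre_sigma \<tau>)" by (rule sets_pre_sigma_AE_mono[OF \<sigma> \<tau> A le])
  have "A \<inter> {\<omega>\<in>space (pre_sigma \<sigma>). g \<omega> \<le> c} \<in> sets (pre_sigma \<sigma>)"
    using A g by (intro sets.Int) (simp_all add: borel_measurable_iff_le)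
  then have "A \<inter> {\<omega>\<in>space (pre_sigma \<sigma>). g \<omega> \<le> c} \<in> sets (pre_sigma \<tau>)"
    by (rule sets_pre_sigma_AE_mono[OF \<sigma> \<tau>]) (use le in auto)
  \<comment> \<open>The product vanishes off \<open>A\<close>, so the complement of \<open>A\<close>
    belongs to the sublevel set exactly when \<open>0 \<le> c\<close>.\<close>
  then have "(A \<inter> {\<omega>\<in>space (pre_sigma \<sigma>). g \<omega> \<le> c}) \<union>
      (if 0 \<le> c then space (pre_sigma \<tau>) - A else {}) \<in> sets (pre_sigma \<tau>)"
    using A\<tau> by auto
  also have "(A \<inter> {\<omega>\<in>space (pre_sigma \<sigma>). g \<omega> \<le> c}) \<union>
      (if 0 \<le> c then space (pre_sigma \<tau>) - A else {})
    = {\<omega>\<in>space (pre_sigma \<tau>). g \<omega> * indicator A \<omega> \<le> c}"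
    using sub by (auto simp: space_pre_sigma indicator_def)
  finally show "{\<omega>\<in>space (pre_sigma \<tau>). g \<omega> * indicator A \<omega> \<le> c} \<in> sets (pre_sigma \<tau>)" .
qed

section \<open>Membership in \<Theta>\<close>

lemma grid_times_stopping:
  "\<tau> \<in> grid_times M F T \<theta> \<Longrightarrow> stopping_time F \<tau>"
  "\<tau> \<in> grid_times M F T \<theta> \<Longrightarrow> \<tau> \<in> space M \<rightarrow> {0..T}"
  by (simp_all add: grid_times_def)

text \<open>The sets \<open>{\<tau> = \<theta> k}\<close> cover almost all of the space but may
  overlap. They all lie in the single \<sigma>-algebra \<open>pre_sigma \<tau>\<close>, so they are
  made disjoint there; only afterwards is the \<open>k\<close>-th piece moved to
  \<open>pre_sigma (\<theta> k)\<close>, on which the two times agree.\<close>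

lemma grid_timesI:
  assumes \<tau>: "stopping_time F \<tau>" "\<tau> \<in> space M \<rightarrow> {0..T}"
    and ex: "AE \<omega> in M. \<exists>k. \<tau> \<omega> = \<theta> k \<omega>"
  shows "\<tau> \<in> grid_times M F T \<theta>"
proof -
  define E where "E k = {\<omega>\<in>space M. \<tau> \<omega> = \<theta> k \<omega>}" for k
  define B where "B = space M - (\<Union>k. E k)"
  have E: "E k \<in> sets (pre_sigma \<tau>)" for k
    unfolding E_def by (rule sets_stopping_time_eq[OF stopping_\<theta> \<tau>])
  have "range (disjointed E) \<subseteq> sets (pre_sigma \<tau>)"
    using E by (intro sets.range_disjointed_sets) auto
  then have dE: "disjointed E k \<in> sets (pre_sigma \<tau>)" for k by auto
  have d\<theta>: "disjointed E k \<in> sets (pre_sigma (\<theta> k))" for k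
    by (rule sets_pre_sigma_AE_mono[OF \<tau>(1) stopping_\<theta> range_\<theta> dE], rule AE_I2)
      (use disjointed_subset[of E k] in \<open>auto simp: E_def\<close>)
  \<comment> \<open>The remainder \<open>B\<close> is null, hence in \<open>F T\<close> by
    completeness.\<close>
  have "AE \<omega> in M. \<omega> \<in> B \<longleftrightarrow> \<omega> \<in> {}"
    using ex by eventually_elim (auto simp: B_def E_def)
  then have B: "B \<in> sets (F T)"
    by (rule sets_F_AE_cong[OF sets.empty_sets less_imp_le[OF T_pos], rotated])
      (simp add: B_def)
  have "AE \<omega> in M. \<tau> \<omega> = (\<Sum>k. \<theta> k \<omega> * indicator (disjointed E k) \<omega>) + T * indicator B \<omega>"
    using ex AE_space
  proof eventually_elim
    case (elim \<omega>)
    then have "\<omega> \<in> (\<Union>k. disjointed E k)" by (auto simp: UN_disjointed_eq E_def)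
    then obtain j where j: "\<omega> \<in> disjointed E j" by blast
    have "\<omega> \<notin> disjointed E k" if "k \<noteq> j" for k
      using disjoint_family_disjointed[of E] j that by (auto simp: disjoint_family_on_def)
    then have "(\<Sum>k. \<theta> k \<omega> * indicator (disjointed E k) \<omega>)
        = (\<Sum>k\<in>{j}. \<theta> k \<omega> * indicator (disjointed E k) \<omega>)"
      by (intro suminf_finite) auto
    moreover have "\<omega> \<in> E j" using j disjointed_subset[of E j] by auto
    moreover from this have "\<tau> \<omega> = \<theta> j \<omega>" "\<omega> \<notin> B" by (auto simp: E_def B_def)
    ultimately show ?case using j by simp
  qed
  moreover have "\<forall>k. disjointed E k \<inter> B = {}"
    using disjointed_subset[of E] by (auto simp: B_def)
  moreover have "(\<Union>k. disjointed E k) \<union> B = space M"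
    by (auto simp: UN_disjointed_eq B_def E_def)
  ultimately show ?thesis
    unfolding grid_times_def using \<tau> d\<theta> B disjoint_family_disjointed[of E] by blast
qed

lemma \<theta>_in_grid_times: "\<theta> k \<in> grid_times M F T \<theta>"
  by (rule grid_timesI) (use stopping_\<theta> range_\<theta> in auto)

lemma AE_\<theta>_mono: "AE \<omega> in M. \<forall>j k. j \<le> k \<longrightarrow> \<theta> j \<omega> \<le> \<theta> k \<omega>"
proof -
  have "AE \<omega> in M. \<forall>k. \<theta> k \<omega> \<le> \<theta> (Suc k) \<omega>"
    using \<theta>_mono by (simp add: AE_all_countable)
  then show ?thesis
    by eventually_elim (auto intro: lift_Suc_mono_le)
qed

end

section \<open>The finite problem and its operators\<close>

text \<open>\<open>P\<close> is an arbitrary choice of representing partitions, so every result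
  about \<open>U\<close> holds for each such choice.\<close>

locale finite_stopping_problem = stopping_grid M F T \<theta>
  for M :: "'a measure" and F T \<theta> +
  fixes p :: ennreal and n :: nat and \<xi> :: "('a \<Rightarrow> real) \<Rightarrow> 'a \<Rightarrow> real"
    and \<rho> :: "'a operator_family" and P :: "('a \<Rightarrow> real) \<Rightarrow> nat \<Rightarrow> 'a set"
    and \<Theta> :: "('a \<Rightarrow> real) set"
  assumes \<Theta>_eq: "\<Theta> = grid_times M F T \<theta>"
    and fin: "\<And>m. m \<ge> n \<Longrightarrow> AE \<omega> in M. \<theta> m \<omega> = T"
    and adm_\<xi>: "admissible_family M F \<Theta> \<xi>"
    and int_\<xi>: "p_integrable_family M F \<Theta> p \<xi>"
    and Lp_\<rho>: "Lp_operators M F \<Theta> p \<rho>"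
    and adm_\<rho>: "admissible_operators M F \<Theta> p \<rho>"
    and know_\<rho>: "knowledge_preserving M F \<Theta> p \<rho>"
    and mono_\<rho>: "monotone_operators M F \<Theta> p \<rho>"
    and cons_\<rho>: "consistent_operators M F \<Theta> p \<rho>"
    and zero_one: "zero_one_law M F \<Theta> p \<rho>"
    and part: "\<And>\<tau>. \<tau> \<in> \<Theta> \<Longrightarrow> grid_partition M F \<theta> n \<tau> (P \<tau>)"
begin

abbreviation V :: "nat \<Rightarrow> 'a \<Rightarrow> real" where
  "V \<equiv> backward_value \<theta> \<rho> \<xi> n"

abbreviation U :: "('a \<Rightarrow> real) \<Rightarrow> 'a \<Rightarrow> real" where
  "U \<equiv> backward_family \<theta> \<rho> \<xi> n P"

lemma V_n: "V n = \<xi> (\<theta> n)"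
  by (subst backward_value.simps) simp

lemma V_less: "k < n \<Longrightarrow> V k = (\<lambda>\<omega>. max (\<xi> (\<theta> k) \<omega>) (\<rho> (\<theta> k) (\<theta> (Suc k)) (V (Suc k)) \<omega>))"
  by (subst backward_value.simps) simp

lemma stopping: "\<tau> \<in> \<Theta> \<Longrightarrow> stopping_time F \<tau>" "\<tau> \<in> \<Theta> \<Longrightarrow> \<tau> \<in> space M \<rightarrow> {0..T}"
  using grid_times_stopping by (auto simp: \<Theta>_eq)

lemma \<theta>_in: "\<theta> k \<in> \<Theta>"
  by (simp add: \<Theta>_eq \<theta>_in_grid_times)

text \<open>At each point the maximum is one of its two arguments, so it takes grid values when they
  do.\<close>

lemma max_in:
  assumes "\<sigma> \<in> \<Theta>" "\<tau> \<in> \<Theta>"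
    and "AE \<omega> in M. \<exists>k. \<sigma> \<omega> = \<theta> k \<omega>" "AE \<omega> in M. \<exists>k. \<tau> \<omega> = \<theta> k \<omega>"
  shows "(\<lambda>\<omega>. max (\<sigma> \<omega>) (\<tau> \<omega>)) \<in> \<Theta>"
  unfolding \<Theta>_eq
proof (rule grid_timesI)
  show "stopping_time F (\<lambda>\<omega>. max (\<sigma> \<omega>) (\<tau> \<omega>))"
    using assms stopping by (intro stopping_time_max) auto
  show "(\<lambda>\<omega>. max (\<sigma> \<omega>) (\<tau> \<omega>)) \<in> space M \<rightarrow> {0..T}"
    using stopping(2)[OF assms(1)] stopping(2)[OF assms(2)] by (fastforce simp: max_def)
  show "AE \<omega> in M. \<exists>k. max (\<sigma> \<omega>) (\<tau> \<omega>) = \<theta> k \<omega>"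
    using assms(3,4) by eventually_elim (auto simp: max_def)
qed

lemma \<rho>_Lp:
  "S \<in> \<Theta> \<Longrightarrow> \<tau> \<in> \<Theta> \<Longrightarrow> \<eta> \<in> Lp M p (pre_sigma \<tau>) \<Longrightarrow> \<rho> S \<tau> \<eta> \<in> Lp M p (pre_sigma S)"
  using Lp_\<rho> by (simp add: Lp_operators_def)

lemma \<rho>_mono:
  "S \<in> \<Theta> \<Longrightarrow> \<tau> \<in> \<Theta> \<Longrightarrow> \<eta>1 \<in> Lp M p (pre_sigma \<tau>) \<Longrightarrow> \<eta>2 \<in> Lp M p (pre_sigma \<tau>) \<Longrightarrow>
    AE \<omega> in M. \<eta>1 \<omega> \<le> \<eta>2 \<omega> \<Longrightarrow> AE \<omega> in M. \<rho> S \<tau> \<eta>1 \<omega> \<le> \<rho> S \<tau> \<eta>2 \<omega>"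
  using mono_\<rho> by (simp add: monotone_operators_def)

lemma \<rho>_adm:
  "S \<in> \<Theta> \<Longrightarrow> S' \<in> \<Theta> \<Longrightarrow> \<tau> \<in> \<Theta> \<Longrightarrow> \<eta> \<in> Lp M p (pre_sigma \<tau>) \<Longrightarrow>
    AE \<omega> in M. S \<omega> = S' \<omega> \<longrightarrow> \<rho> S \<tau> \<eta> \<omega> = \<rho> S' \<tau> \<eta> \<omega>"
  using adm_\<rho> by (simp add: admissible_operators_def)

text \<open>Knowledge preservation makes \<open>\<rho> \<tau> \<tau>\<close> the identity, and
  admissibility carries this over to \<open>\<rho> S \<tau>\<close> on the event where
  \<open>S\<close> and \<tau> agree.\<close>

lemma \<rho>_self_on_eq:
  assumes "S \<in> \<Theta>" "\<tau> \<in> \<Theta>" "\<eta> \<in> Lp M p (pre_sigma \<tau>)"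
  shows "AE \<omega> in M. S \<omega> = \<tau> \<omega> \<longrightarrow> \<rho> S \<tau> \<eta> \<omega> = \<eta> \<omega>"
proof -
  have "\<tau> \<in> grid_times_from M \<Theta> \<tau>"
    using assms(2) by (simp add: grid_times_from_def)
  then have "AE \<omega> in M. \<rho> \<tau> \<tau> \<eta> \<omega> = \<eta> \<omega>"
    using know_\<rho> assms by (auto simp: knowledge_preserving_def)
  then show ?thesis
    using \<rho>_adm[OF assms(1) assms(2) assms(2,3)] by eventually_elim auto
qed

lemma \<xi>_Lp: "\<tau> \<in> \<Theta> \<Longrightarrow> \<xi> \<tau> \<in> Lp M p (pre_sigma \<tau>)"
  using int_\<xi> by (simp add: p_integrable_family_def)

lemma family_eq:
  "admissible_family M F \<Theta> \<phi> \<Longrightarrow> \<sigma> \<in> \<Theta> \<Longrightarrow> \<tau> \<in> \<Theta> \<Longrightarrow> AE \<omega> in M. \<sigma> \<omega> = \<tau> \<omega> \<longrightarrow> \<phi> \<sigma> \<omega> = \<phi> \<tau> \<omega>"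
  by (simp add: admissible_family_def)

section \<open>The backward values along the grid\<close>

text \<open>A maximum of two functions equals one of them pointwise, so domination with a
  two-element index set suffices.\<close>

lemma V_Lp: "k \<le> n \<Longrightarrow> V k \<in> Lp M p (pre_sigma (\<theta> k))"
proof (induction k rule: inc_induct)
  case base
  then show ?case by (simp add: V_n \<xi>_Lp \<theta>_in)
next
  case (step k)
  let ?r = "\<rho> (\<theta> k) (\<theta> (Suc k)) (V (Suc k))"
  have r: "?r \<in> Lp M p (pre_sigma (\<theta> k))"
    using step by (intro \<rho>_Lp \<theta>_in)
  have x: "\<xi> (\<theta> k) \<in> Lp M p (pre_sigma (\<theta> k))" by (simp add: \<xi>_Lp \<theta>_in)
  show ?case
    unfolding V_less[OF step(2)]
  proof (rule Lp_dominated[where I="{True, False}" and g="\<lambda>b. if b then \<xi> (\<theta> k) else ?r"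
        and H="\<lambda>_. pre_sigma (\<theta> k)"])
    show "(\<lambda>\<omega>. max (\<xi> (\<theta> k) \<omega>) (?r \<omega>)) \<in> borel_measurable (pre_sigma (\<theta> k))"
      using borel_measurable_Lp[OF r] borel_measurable_Lp[OF x] by simp
    show "sets (pre_sigma (\<theta> k)) \<subseteq> sets M"
      by (rule sets_pre_sigma_subset[OF stopping_\<theta> range_\<theta>])
    show "space (pre_sigma (\<theta> k)) = space M" by (rule space_pre_sigma)
  qed (use r x in \<open>auto simp: max_def split: if_splits\<close>)
qed

lemma \<xi>_le_V: "k \<le> n \<Longrightarrow> \<xi> (\<theta> k) \<omega> \<le> V k \<omega>"
  by (cases "k = n") (auto simp: V_n V_less)

text \<open>Where the two grid times coincide, the operator returns \<open>V (Suc k)\<close> and the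
  reward is \<open>\<xi> (\<theta> (Suc k))\<close>, which is at most \<open>V (Suc k)\<close>; the
  maximum is therefore \<open>V (Suc k)\<close>.\<close>

lemma V_Suc_eq:
  assumes "k < n"
  shows "AE \<omega> in M. \<theta> k \<omega> = \<theta> (Suc k) \<omega> \<longrightarrow> V k \<omega> = V (Suc k) \<omega>"
proof -
  have "AE \<omega> in M. \<theta> k \<omega> = \<theta> (Suc k) \<omega> \<longrightarrow> \<rho> (\<theta> k) (\<theta> (Suc k)) (V (Suc k)) \<omega> = V (Suc k) \<omega>"
    using assms by (intro \<rho>_self_on_eq \<theta>_in V_Lp) auto
  with family_eq[OF adm_\<xi> \<theta>_in[of k] \<theta>_in[of "Suc k"]] show ?thesis
  proof eventually_elim
    case (elim \<omega>)
    then show ?case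
      using \<xi>_le_V[of "Suc k" \<omega>] assms by (auto simp: V_less max_def)
  qed
qed

text \<open>The grid is almost surely nondecreasing, so equality at two indices forces equality at
  all indices between them, and the one-step statement can be chained.\<close>

lemma V_eq: "AE \<omega> in M. \<forall>j\<le>n. \<forall>k\<le>n. \<theta> j \<omega> = \<theta> k \<omega> \<longrightarrow> V j \<omega> = V k \<omega>"
proof -
  have "AE \<omega> in M. \<forall>k\<in>{..<n}. \<theta> k \<omega> = \<theta> (Suc k) \<omega> \<longrightarrow> V k \<omega> = V (Suc k) \<omega>"
    using V_Suc_eq by (simp add: AE_finite_all)
  with AE_\<theta>_mono show ?thesis
  proof eventually_elim
    case (elim \<omega>)
    have *: "V j \<omega> = V k \<omega>" if "j \<le> k" "k \<le> n" "\<theta> j \<omega> = \<theta> k \<omega>" for j k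
      using that
    proof (induction k rule: dec_induct)
      case base
      then show ?case by simp
    next
      case (step k)
      have "\<theta> j \<omega> \<le> \<theta> k \<omega>" "\<theta> k \<omega> \<le> \<theta> (Suc k) \<omega>"
        using elim(1) step.hyps by simp_all
      then have "\<theta> j \<omega> = \<theta> k \<omega>" "\<theta> k \<omega> = \<theta> (Suc k) \<omega>"
        using step.prems by linarith+
      then show ?case using step elim by auto
    qed
    show ?case by (metis * nat_le_linear)
  qed
qed

section \<open>The family \<open>U\<close>: independence of the partition, integrability,
  admissibility\<close>

lemma U_on_block:
  assumes "\<tau> \<in> \<Theta>"
  shows "AE \<omega> in M. \<exists>k\<le>n. \<omega> \<in> P \<tau> k \<and> \<tau> \<omega> = \<theta> k \<omega> \<and> U \<tau> \<omega> = V k \<omega>"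
proof -
  note gp = part[OF assms, unfolded grid_partition_def]
  have "AE \<omega> in M. \<tau> \<omega> = (\<Sum>k\<le>n. \<theta> k \<omega> * indicator (P \<tau> k) \<omega>)" using gp by blast
  then show ?thesis
    using AE_space
  proof eventually_elim
    case (elim \<omega>)
    then obtain j where j: "j \<le> n" "\<omega> \<in> P \<tau> j" using gp by blast
    \<comment> \<open>For general \<open>f\<close>, because it evaluates both \<tau>, with
      \<open>\<theta> k \<omega>\<close>, and \<open>U \<tau>\<close>, with
      \<open>V k \<omega>\<close>.\<close>
    have "(\<Sum>k\<le>n. f k * indicator (P \<tau> k) \<omega>) = f j" for f :: "nat \<Rightarrow> real"
    proof -
      have "(\<Sum>k\<le>n. f k * indicator (P \<tau> k) \<omega>) = (\<Sum>k\<le>n. if k = j then f j else 0)"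
        using j gp by (intro sum.cong) (auto simp: disjoint_family_on_def indicator_def)
      then show ?thesis using j by simp
    qed
    with elim j show ?case by (auto simp: backward_family_def)
  qed
qed

lemma AE_on_grid:
  assumes "\<tau> \<in> \<Theta>"
  shows "AE \<omega> in M. \<exists>k\<le>n. \<tau> \<omega> = \<theta> k \<omega>"
  using U_on_block[OF assms] by eventually_elim auto

lemma max_\<theta>_in: "\<tau> \<in> \<Theta> \<Longrightarrow> (\<lambda>\<omega>. max (\<tau> \<omega>) (\<theta> k \<omega>)) \<in> \<Theta>"
  using AE_on_grid[of \<tau>] by (intro max_in \<theta>_in) auto

text \<open>The index \<open>k\<close> need not be that of the block containing \<omega>:
  \<open>V_eq\<close> shows that all indices with the same grid value give the same
  \<open>V\<close>. Hence the partition does not matter.\<close>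

lemma U_at:
  assumes "\<tau> \<in> \<Theta>"
  shows "AE \<omega> in M. \<forall>k\<le>n. \<tau> \<omega> = \<theta> k \<omega> \<longrightarrow> U \<tau> \<omega> = V k \<omega>"
  using U_on_block[OF assms] V_eq by eventually_elim metis

lemma U_Lp:
  assumes \<tau>: "\<tau> \<in> \<Theta>"
  shows "U \<tau> \<in> Lp M p (pre_sigma \<tau>)"
proof (rule Lp_dominated[where I="{..n}" and g=V and H="\<lambda>k. pre_sigma (\<theta> k)"])
  note gp = part[OF \<tau>, unfolded grid_partition_def]
  \<comment> \<open>By disjointness, the block found by \<open>U_on_block\<close> is the
    \<open>k\<close>-th one, where \<tau> equals \<open>\<theta> k\<close>.\<close>
  have block: "AE \<omega> in M. \<omega> \<in> P \<tau> k \<longrightarrow> \<theta> k \<omega> \<le> \<tau> \<omega>" if "k \<le> n" for k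
    using U_on_block[OF \<tau>]
  proof eventually_elim
    case (elim \<omega>)
    then obtain j where "j \<le> n" "\<omega> \<in> P \<tau> j" "\<tau> \<omega> = \<theta> j \<omega>" by blast
    then show ?case using gp that by (cases "j = k") (auto simp: disjoint_family_on_def)
  qed
  show "U \<tau> \<in> borel_measurable (pre_sigma \<tau>)"
    unfolding backward_family_def
  proof (rule borel_measurable_sum)
    fix k assume "k \<in> {..n}"
    then have k: "k \<le> n" by simp
    show "(\<lambda>\<omega>. V k \<omega> * indicator (P \<tau> k) \<omega>) \<in> borel_measurable (pre_sigma \<tau>)"
      by (rule measurable_mult_indicator_pre_sigma[OF stopping_\<theta> stopping[OF \<tau>]
            borel_measurable_Lp[OF V_Lp[OF k]] _ block[OF k]]) (use gp k in blast)
  qed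
  show "sets (pre_sigma \<tau>) \<subseteq> sets M"
    by (rule sets_pre_sigma_subset[OF stopping[OF \<tau>]])
  show "AE \<omega> in M. \<exists>k\<in>{..n}. \<bar>U \<tau> \<omega>\<bar> \<le> \<bar>V k \<omega>\<bar>"
    using U_on_block[OF \<tau>] by eventually_elim auto
qed (use V_Lp in \<open>auto simp: space_pre_sigma\<close>)

lemma U_p_integrable: "p_integrable_family M F \<Theta> p U"
  by (simp add: p_integrable_family_def U_Lp)

lemma U_admissible: "admissible_family M F \<Theta> U"
  unfolding admissible_family_def
proof (intro conjI ballI)
  fix \<tau> \<tau>' assume \<tau>: "\<tau> \<in> \<Theta>" "\<tau>' \<in> \<Theta>"
  show "AE \<omega> in M. \<tau> \<omega> = \<tau>' \<omega> \<longrightarrow> U \<tau> \<omega> = U \<tau>' \<omega>"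
    using U_on_block[OF \<tau>(1)] U_at[OF \<tau>(2)] by eventually_elim metis
qed (use U_Lp borel_measurable_Lp in blast)

section \<open>The supermartingale property\<close>

text \<open>The zero-one law applied to the family \<open>U\<close> itself, which has been shown
  admissible and \<open>p\<close>-integrable.\<close>

lemma zero_one_U:
  assumes S: "S \<in> \<Theta>" and A: "A \<in> sets (pre_sigma S)" and \<tau>: "\<tau> \<in> \<Theta>" "\<tau>' \<in> \<Theta>"
    and ge: "AE \<omega> in M. S \<omega> \<le> \<tau> \<omega>" "AE \<omega> in M. S \<omega> \<le> \<tau>' \<omega>"
    and eq: "AE \<omega> in M. \<omega> \<in> A \<longrightarrow> \<tau> \<omega> = \<tau>' \<omega>"
  shows "AE \<omega> in M. \<omega> \<in> A \<longrightarrow> \<rho> S \<tau> (U \<tau>) \<omega> = \<rho> S \<tau>' (U \<tau>') \<omega>"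
proof -
  have "AE \<omega> in M. indicator A \<omega> * \<rho> S \<tau> (U \<tau>) \<omega> = indicator A \<omega> * \<rho> S \<tau>' (U \<tau>') \<omega>"
    using zero_one U_admissible U_p_integrable S A \<tau> ge eq
    by (simp add: zero_one_law_def grid_times_from_def)
  then show ?thesis by eventually_elim auto
qed

text \<open>The induction keeps \<tau> arbitrary because its hypothesis is applied to a different
  time, \<open>\<tau>'\<close>, which is at least \<open>\<theta> (Suc k)\<close>.\<close>

lemma \<rho>_U_le_V:
  assumes "k \<le> n" "\<tau> \<in> \<Theta>" "AE \<omega> in M. \<theta> k \<omega> \<le> \<tau> \<omega>"
  shows "AE \<omega> in M. \<rho> (\<theta> k) \<tau> (U \<tau>) \<omega> \<le> V k \<omega>"
  using assms
proof (induction k arbitrary: \<tau> rule: inc_induct)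
  case base
  show ?case
    using \<rho>_self_on_eq[OF \<theta>_in[of n] base(1) U_Lp[OF base(1)]] base(2) fin[of n, simplified]
      U_at[OF base(1)] AE_space
  proof eventually_elim
    case (elim \<omega>)
    \<comment> \<open>Here \<open>\<theta> n\<close> has the value \<open>T\<close>, the upper bound
      of \<tau>, so \<open>\<theta> n \<omega> \<le> \<tau> \<omega>\<close> leaves only
      equality.\<close>
    then have "\<tau> \<omega> = \<theta> n \<omega>" using stopping(2)[OF base(1)] by force
    then show ?case using elim by auto
  qed
next
  case (step k)
  define \<tau>' where "\<tau>' = (\<lambda>\<omega>. max (\<tau> \<omega>) (\<theta> (Suc k) \<omega>))"
  define A where "A = {\<omega>\<in>space M. \<theta> k \<omega> < \<tau> \<omega>}"
  let ?\<theta> = "\<theta> (Suc k)"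
  have \<tau>'_in: "\<tau>' \<in> \<Theta>" unfolding \<tau>'_def by (rule max_\<theta>_in) fact
  have le': "AE \<omega> in M. ?\<theta> \<omega> \<le> \<tau>' \<omega>" by (simp add: \<tau>'_def)
  have A: "A \<in> sets (pre_sigma (\<theta> k))"
    using stopping_time_less[OF stopping_\<theta>[of k] stopping(1)[OF step.prems(1)]]
    by (simp add: A_def pred_def space_pre_sigma)
  \<comment> \<open>There is no grid value strictly between \<open>\<theta> k\<close> and
    \<open>\<theta> (Suc k)\<close>: a value above \<open>\<theta> k\<close> has index at least
    \<open>Suc k\<close>.\<close>
  have "AE \<omega> in M. \<omega> \<in> A \<longrightarrow> \<tau> \<omega> = \<tau>' \<omega>"
    using AE_on_grid[OF step.prems(1)] AE_\<theta>_mono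
  proof eventually_elim
    case (elim \<omega>)
    then obtain j where j: "\<tau> \<omega> = \<theta> j \<omega>" by blast
    show ?case
    proof
      assume "\<omega> \<in> A"
      then have "\<theta> k \<omega> < \<theta> j \<omega>" by (simp add: A_def j)
      then have "Suc k \<le> j" using elim by (meson not_less not_less_eq_eq)
      then have "\<theta> (Suc k) \<omega> \<le> \<theta> j \<omega>" using elim(2) by blast
      then show "\<tau> \<omega> = \<tau>' \<omega>" by (simp add: \<tau>'_def j)
    qed
  qed
  moreover have "AE \<omega> in M. \<theta> k \<omega> \<le> \<tau>' \<omega>"
    using step.prems(2) by eventually_elim (simp add: \<tau>'_def)
  ultimately have on_A: "AE \<omega> in M. \<omega> \<in> A \<longrightarrow> \<rho> (\<theta> k) \<tau> (U \<tau>) \<omega> = \<rho> (\<theta> k) \<tau>' (U \<tau>') \<omega>"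
    using step.prems by (intro zero_one_U[OF \<theta>_in A _ \<tau>'_in]) auto
  \<comment> \<open>The right-hand side is the second entry of the maximum defining
    \<open>V k\<close>; consistency then collapses the left-hand side to
    \<open>\<rho> (\<theta> k) \<tau>' (U \<tau>')\<close>.\<close>
  have "AE \<omega> in M. \<rho> (\<theta> k) ?\<theta> (\<rho> ?\<theta> \<tau>' (U \<tau>')) \<omega> \<le> \<rho> (\<theta> k) ?\<theta> (V (Suc k)) \<omega>"
    using step.hyps step.IH[OF \<tau>'_in le'] \<tau>'_in by (intro \<rho>_mono \<rho>_Lp U_Lp V_Lp \<theta>_in) auto
  moreover have "AE \<omega> in M. \<rho> (\<theta> k) ?\<theta> (\<rho> ?\<theta> \<tau>' (U \<tau>')) \<omega> = \<rho> (\<theta> k) \<tau>' (U \<tau>') \<omega>"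
    using cons_\<rho> \<theta>_in \<tau>'_in le' \<theta>_mono U_Lp by (simp add: consistent_operators_def)
  moreover note \<rho>_self_on_eq[OF \<theta>_in[of k] step.prems(1) U_Lp[OF step.prems(1)]]
    on_A step.prems(2) U_at[OF step.prems(1)] AE_space
  ultimately show ?case
  proof eventually_elim
    case (elim \<omega>)
    show ?case
    proof (cases "\<omega> \<in> A")
      case True
      then show ?thesis using elim step.hyps by (auto simp: V_less)
    next
      case False
      then have \<tau>k: "\<tau> \<omega> = \<theta> k \<omega>" using elim by (auto simp: A_def)
      then have "U \<tau> \<omega> = V k \<omega>" using elim less_imp_le[OF step.hyps(2)] by blast
      then show ?thesis using elim \<tau>k by auto
    qed
  qed
qed

lemma U_supermartingale: "supermartingale_family M F \<Theta> p \<rho> U"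
  unfolding supermartingale_family_def
proof (intro conjI ballI impI U_admissible U_p_integrable)
  fix \<sigma> \<tau> assume \<sigma>: "\<sigma> \<in> \<Theta>" and \<tau>: "\<tau> \<in> \<Theta>" and le: "AE \<omega> in M. \<sigma> \<omega> \<le> \<tau> \<omega>"
  have "AE \<omega> in M. \<sigma> \<omega> = \<theta> k \<omega> \<longrightarrow> \<rho> \<sigma> \<tau> (U \<tau>) \<omega> \<le> V k \<omega>" if k: "k \<le> n" for k
  proof -
    \<comment> \<open>Away from \<open>{\<sigma> = \<theta> k}\<close> the time \<tau> may lie below
      \<open>\<theta> k\<close>, whereas \<open>\<rho>_U_le_V\<close> needs a time above
      \<open>\<theta> k\<close> almost everywhere.\<close>
    define \<tau>' where "\<tau>' = (\<lambda>\<omega>. max (\<tau> \<omega>) (\<theta> k \<omega>))"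
    define A where "A = {\<omega>\<in>space M. \<sigma> \<omega> = \<theta> k \<omega>}"
    have \<tau>'_in: "\<tau>' \<in> \<Theta>" unfolding \<tau>'_def by (rule max_\<theta>_in) fact
    have A: "A \<in> sets (pre_sigma \<sigma>)"
      unfolding A_def by (rule sets_stopping_time_eq[OF stopping_\<theta> stopping[OF \<sigma>]])
    have "AE \<omega> in M. \<sigma> \<omega> \<le> \<tau>' \<omega>" "AE \<omega> in M. \<omega> \<in> A \<longrightarrow> \<tau> \<omega> = \<tau>' \<omega>"
      using le by (eventually_elim, simp add: \<tau>'_def A_def max_def)+
    then have "AE \<omega> in M. \<omega> \<in> A \<longrightarrow> \<rho> \<sigma> \<tau> (U \<tau>) \<omega> = \<rho> \<sigma> \<tau>' (U \<tau>') \<omega>"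
      by (intro zero_one_U[OF \<sigma> A \<tau> \<tau>'_in le])
    moreover have "AE \<omega> in M. \<rho> (\<theta> k) \<tau>' (U \<tau>') \<omega> \<le> V k \<omega>"
      by (rule \<rho>_U_le_V[OF k \<tau>'_in]) (simp add: \<tau>'_def)
    \<comment> \<open>Admissibility replaces \<sigma> by \<open>\<theta> k\<close> as the evaluation
      time on \<open>A\<close>.\<close>
    moreover note \<rho>_adm[OF \<sigma> \<theta>_in[of k] \<tau>'_in U_Lp[OF \<tau>'_in]] AE_space
    ultimately show ?thesis by eventually_elim (auto simp: A_def)
  qed
  then have "AE \<omega> in M. \<forall>k\<in>{..n}. \<sigma> \<omega> = \<theta> k \<omega> \<longrightarrow> \<rho> \<sigma> \<tau> (U \<tau>) \<omega> \<le> V k \<omega>"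
    by (simp add: AE_finite_all)
  then show "AE \<omega> in M. \<rho> \<sigma> \<tau> (U \<tau>) \<omega> \<le> U \<sigma> \<omega>"
    using U_on_block[OF \<sigma>] by eventually_elim (metis atMost_iff)
qed

section \<open>Domination and minimality\<close>

text \<open>An admissible family is determined by its values at the finitely many grid times, so
  comparison with \<open>U\<close> reduces to comparison with \<open>V\<close>. One direction serves
  minimality, the other domination of \<xi>.\<close>

lemma dominates_from_grid:
  assumes adm: "admissible_family M F \<Theta> \<phi>"
  shows "(\<And>k. k \<le> n \<Longrightarrow> AE \<omega> in M. V k \<omega> \<le> \<phi> (\<theta> k) \<omega>) \<Longrightarrow> dominates M \<Theta> \<phi> U"
    and "(\<And>k. k \<le> n \<Longrightarrow> AE \<omega> in M. \<phi> (\<theta> k) \<omega> \<le> V k \<omega>) \<Longrightarrow> dominates M \<Theta> U \<phi>"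
proof -
  have eq: "AE \<omega> in M. \<exists>k\<le>n. \<phi> \<tau> \<omega> = \<phi> (\<theta> k) \<omega> \<and> U \<tau> \<omega> = V k \<omega>" if "\<tau> \<in> \<Theta>" for \<tau>
  proof -
    have "AE \<omega> in M. \<forall>k\<in>{..n}. \<tau> \<omega> = \<theta> k \<omega> \<longrightarrow> \<phi> \<tau> \<omega> = \<phi> (\<theta> k) \<omega>"
      using family_eq[OF adm that \<theta>_in] by (simp add: AE_finite_all)
    then show ?thesis using U_on_block[OF that] by eventually_elim auto
  qed
  {
    assume "\<And>k. k \<le> n \<Longrightarrow> AE \<omega> in M. V k \<omega> \<le> \<phi> (\<theta> k) \<omega>"
    then have le: "AE \<omega> in M. \<forall>k\<in>{..n}. V k \<omega> \<le> \<phi> (\<theta> k) \<omega>" by (simp add: AE_finite_all)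
    show "dominates M \<Theta> \<phi> U"
      unfolding dominates_def
    proof
      fix \<tau> assume "\<tau> \<in> \<Theta>"
      from eq[OF this] le show "AE \<omega> in M. U \<tau> \<omega> \<le> \<phi> \<tau> \<omega>" by eventually_elim auto
    qed
  next
    assume "\<And>k. k \<le> n \<Longrightarrow> AE \<omega> in M. \<phi> (\<theta> k) \<omega> \<le> V k \<omega>"
    then have le: "AE \<omega> in M. \<forall>k\<in>{..n}. \<phi> (\<theta> k) \<omega> \<le> V k \<omega>" by (simp add: AE_finite_all)
    show "dominates M \<Theta> U \<phi>"
      unfolding dominates_def
    proof
      fix \<tau> assume "\<tau> \<in> \<Theta>"
      from eq[OF this] le show "AE \<omega> in M. \<phi> \<tau> \<omega> \<le> U \<tau> \<omega>" by eventually_elim auto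
    qed
  }
qed

text \<open>\<open>W (\<theta> k)\<close> bounds both entries of the maximum: the reward by
  domination, and the operator term because monotonicity replaces \<open>V (Suc k)\<close> by
  \<open>W (\<theta> (Suc k))\<close>, to which the supermartingale inequality applies.\<close>

lemma V_le_supermartingale:
  assumes W: "supermartingale_family M F \<Theta> p \<rho> W" and dom: "dominates M \<Theta> W \<xi>"
    and k: "k \<le> n"
  shows "AE \<omega> in M. V k \<omega> \<le> W (\<theta> k) \<omega>"
  using k
proof (induction k rule: inc_induct)
  case base
  then show ?case using dom \<theta>_in by (simp add: V_n dominates_def)
next
  case (step k)
  let ?\<theta> = "\<theta> (Suc k)"
  have "W ?\<theta> \<in> Lp M p (pre_sigma ?\<theta>)"
    using W \<theta>_in by (simp add: supermartingale_family_def p_integrable_family_def)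
  then have "AE \<omega> in M. \<rho> (\<theta> k) ?\<theta> (V (Suc k)) \<omega> \<le> \<rho> (\<theta> k) ?\<theta> (W ?\<theta>) \<omega>"
    using step by (intro \<rho>_mono \<theta>_in V_Lp) auto
  moreover have "AE \<omega> in M. \<rho> (\<theta> k) ?\<theta> (W ?\<theta>) \<omega> \<le> W (\<theta> k) \<omega>"
    using W \<theta>_in \<theta>_mono by (simp add: supermartingale_family_def)
  moreover have "AE \<omega> in M. \<xi> (\<theta> k) \<omega> \<le> W (\<theta> k) \<omega>"
    using dom \<theta>_in by (simp add: dominates_def)
  ultimately show ?case
    by eventually_elim (use step.hyps in \<open>auto simp: V_less\<close>)
qed

lemma snell_envelope_U: "snell_envelope M F \<Theta> p \<rho> \<xi> U"
  unfolding snell_envelope_def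
proof (intro conjI allI impI U_supermartingale)
  show "dominates M \<Theta> U \<xi>"
    by (rule dominates_from_grid(2)[OF adm_\<xi>]) (simp add: \<xi>_le_V)
next
  fix W assume W: "supermartingale_family M F \<Theta> p \<rho> W" "dominates M \<Theta> W \<xi>"
  show "dominates M \<Theta> W U"
    using W(1) V_le_supermartingale[OF W]
    by (intro dominates_from_grid(1)) (auto simp: supermartingale_family_def)
qed

end

theorem theorem4p2:
  fixes M :: "'a measure" and F :: "real \<Rightarrow> 'a measure" and T :: real
    and \<theta> :: "nat \<Rightarrow> 'a \<Rightarrow> real" and \<Theta> :: "('a \<Rightarrow> real) set" and p :: ennreal and n :: nat
    and \<xi> :: "('a \<Rightarrow> real) \<Rightarrow> 'a \<Rightarrow> real" and \<rho> :: "'a operator_family"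
    and P :: "('a \<Rightarrow> real) \<Rightarrow> nat \<Rightarrow> 'a set"
  assumes "stopping_grid M F T \<theta>"
    and "\<Theta> = grid_times M F T \<theta>"
    and "1 \<le> p"
    and "1 \<le> n"
    and "\<And>m. m \<ge> n \<Longrightarrow> AE \<omega> in M. \<theta> m \<omega> = T"
    and "admissible_family M F \<Theta> \<xi>"
    and "p_integrable_family M F \<Theta> p \<xi>"
    and "Lp_operators M F \<Theta> p \<rho>"
    and "admissible_operators M F \<Theta> p \<rho>"
    and "knowledge_preserving M F \<Theta> p \<rho>"
    and "monotone_operators M F \<Theta> p \<rho>"
    and "consistent_operators M F \<Theta> p \<rho>"
    and "zero_one_law M F \<Theta> p \<rho>"
    and "\<And>\<tau>. \<tau> \<in> \<Theta> \<Longrightarrow> grid_partition M F \<theta> n \<tau> (P \<tau>)"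
  shows "snell_envelope M F \<Theta> p \<rho> \<xi> (backward_family \<theta> \<rho> \<xi> n P)"
proof -
  interpret finite_stopping_problem M F T \<theta> p n \<xi> \<rho> P \<Theta>
    by (intro finite_stopping_problem.intro finite_stopping_problem_axioms.intro assms)
  show ?thesis by (rule snell_envelope_U)
qed

end
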